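(* Let $G$ be a finite group with supercharacter theory $S$, and suppose $G$ is not $S$-abelian. The following hold. (1) For each $S$-normal subgroup $N$ of $G$, the subgroup $U(S\mid N)$ is the unique largest subgroup $U\leq G$ such that every character in $\mathrm{Irr}(S\mid U)$ vanishes on $G\setminus N$. (2) For each $S$-normal subgroup $N$ of $G$ and every element $g\in G$, we have $g\in U(S\mid N)$ if and only if every character $\chi\in\mathrm{Irr}(S)$ with $g\notin\ker(\chi)$ vanishes on $G\setminus N$.
   Context: $\mathrm{Irr}(G)$ is the set of complex irreducible characters of the finite group $G$. A supercharacter theory $S$ of $G$ is a pair $(\mathcal X,\mathcal Y)$, where $\mathcal X$ is a partition of $\mathrm{Irr}(G)$ and $\mathcal Y$ is a partition of $G$, such that $\{1\}\in\mathcal Y$, $|\mathcal X|=|\mathcal Y|$, and for each $X\in\mathcal X$ the character $\sigma_X=\sum_{\chi\in X}\chi(1)\chi$ is constant on each $Y\in\mathcal Y$. The parts $Y\in\mathcal Y$ are the $S$-classes, $\mathrm{Cl}_S(g)$ is the $S$-class containing $g$, the characters $\sigma_X$ are the $S$-characters, and $\mathrm{Irr}(S)=\{\sigma_X: X\in\mathcal X\}$. For a character $\chi$, $\ker(\chi)=\{g\in G:\chi(g)=\chi(1)\}$. A subgroup $N\le G$ is $S$-normal if it is a union of $S$-classes. $Z(S)=\{g\in G: |\mathrm{Cl}_S(g)|=1\}$, and $G$ is $S$-abelian if $Z(S)=G$. For a subgroup $N\le G$, $\mathrm{Irr}(S\mid N)$ is the set of $\chi\in\mathrm{Irr}(S)$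 with $N\not\le\ker(\chi)$. For $N$ $S$-normal, $V(S\mid N)=\langle g\in G: \text{there exists }\chi\in\mathrm{Irr}(S\mid N)\text{ with }\chi(g)\ne0\rangle$, and $U(S\mid N)$ is the product of all $S$-normal subgroups $H$ of $G$ such that $V(S\mid H)\le N$. *)

theory Defs
  imports
    Jordan_Normal_Form.VS_Connect
    "HOL-Algebra.Coset"
    "HOL-Algebra.Generated_Groups"
    "HOL-Library.Disjoint_Sets"
begin

definition GL :: "nat \<Rightarrow> complex mat monoid" where
  "GL n = units_of (ring_mat TYPE(complex) n ())"

definition irreducible_rep ::
  "('a, 'b) monoid_scheme \<Rightarrow> nat \<Rightarrow> ('a \<Rightarrow> complex mat) \<Rightarrow> bool" where
  "irreducible_rep G n \<rho> \<longleftrightarrow>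
     n > 0 \<and> \<rho> \<in> hom G (GL n) \<and>
     (\<forall>W. subspace class_ring W (module_vec TYPE(complex) n) \<and>
          (\<forall>g\<in>carrier G. \<forall>w\<in>W. \<rho> g *\<^sub>v w \<in> W)
        \<longrightarrow> W = {0\<^sub>v n} \<or> W = carrier_vec n)"

text \<open>
  Class functions, and characters in particular, are extensional functions on the carrier, so that
  equality of characters is equality on the group.
\<close>

definition rep_character ::
  "('a, 'b) monoid_scheme \<Rightarrow> nat \<Rightarrow> ('a \<Rightarrow> complex mat) \<Rightarrow> 'a \<Rightarrow> complex" where
  "rep_character G n \<rho> = (\<lambda>g\<in>carrier G. \<Sum>i<n. \<rho> g $$ (i, i))"

definition Irr :: "('a, 'b) monoid_scheme \<Rightarrow> ('a \<Rightarrow> complex) set" where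
  "Irr G = {rep_character G n \<rho> | n \<rho>. irreducible_rep G n \<rho>}"

definition char_ker :: "('a, 'b) monoid_scheme \<Rightarrow> ('a \<Rightarrow> complex) \<Rightarrow> 'a set" where
  "char_ker G \<chi> = {g \<in> carrier G. \<chi> g = \<chi> \<one>\<^bsub>G\<^esub>}"

definition vanishes_on :: "('a \<Rightarrow> complex) \<Rightarrow> 'a set \<Rightarrow> bool" where
  "vanishes_on \<chi> A \<longleftrightarrow> (\<forall>g\<in>A. \<chi> g = 0)"

text \<open>The pair \<open>(\<X>, \<Y>)\<close>.\<close>

type_synonym 'a sct = "('a \<Rightarrow> complex) set set \<times> 'a set set"

text \<open>The sum is a genuine one because \<open>Irr G\<close> is finite for finite \<open>G\<close>.\<close>

definition sigma_char ::
  "('a, 'b) monoid_scheme \<Rightarrow> ('a \<Rightarrow> complex) set \<Rightarrow> 'a \<Rightarrow> complex" where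
  "sigma_char G X = (\<lambda>g\<in>carrier G. \<Sum>\<chi>\<in>X. \<chi> \<one>\<^bsub>G\<^esub> * \<chi> g)"

definition supercharacter_theory :: "('a, 'b) monoid_scheme \<Rightarrow> 'a sct \<Rightarrow> bool" where
  "supercharacter_theory G S \<longleftrightarrow>
     partition_on (Irr G) (fst S) \<and>
     partition_on (carrier G) (snd S) \<and>
     {\<one>\<^bsub>G\<^esub>} \<in> snd S \<and>
     card (fst S) = card (snd S) \<and>
     (\<forall>X\<in>fst S. \<forall>Y\<in>snd S. \<exists>c. \<forall>g\<in>Y. sigma_char G X g = c)"

definition S_class :: "'a sct \<Rightarrow> 'a \<Rightarrow> 'a set" where
  "S_class S g = (THE Y. Y \<in> snd S \<and> g \<in> Y)"

definition Irr_S :: "('a, 'b) monoid_scheme \<Rightarrow> 'a sct \<Rightarrow> ('a \<Rightarrow> complex) set" where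
  "Irr_S G S = sigma_char G ` fst S"

definition S_normal :: "('a, 'b) monoid_scheme \<Rightarrow> 'a sct \<Rightarrow> 'a set \<Rightarrow> bool" where
  "S_normal G S N \<longleftrightarrow> subgroup N G \<and> (\<exists>C \<subseteq> snd S. N = \<Union>C)"

definition S_center :: "('a, 'b) monoid_scheme \<Rightarrow> 'a sct \<Rightarrow> 'a set" where
  "S_center G S = {g \<in> carrier G. card (S_class S g) = 1}"

definition S_abelian :: "('a, 'b) monoid_scheme \<Rightarrow> 'a sct \<Rightarrow> bool" where
  "S_abelian G S \<longleftrightarrow> S_center G S = carrier G"

definition Irr_S_rel ::
  "('a, 'b) monoid_scheme \<Rightarrow> 'a sct \<Rightarrow> 'a set \<Rightarrow> ('a \<Rightarrow> complex) set" where
  "Irr_S_rel G S N = {\<chi> \<in> Irr_S G S. \<not> N \<subseteq> char_ker G \<chi>}"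

definition V_sub :: "('a, 'b) monoid_scheme \<Rightarrow> 'a sct \<Rightarrow> 'a set \<Rightarrow> 'a set" where
  "V_sub G S N = generate G {g \<in> carrier G. \<exists>\<chi>\<in>Irr_S_rel G S N. \<chi> g \<noteq> 0}"

text \<open>
  The product \<open>H\<^sub>1 \<cdots> H\<^sub>k\<close> of a finite family of subgroups, in an unspecified order.  It is only
  used for families of \<open>S\<close>-normal subgroups; these are normal, so the order is irrelevant.
\<close>

definition subgroup_product :: "('a, 'b) monoid_scheme \<Rightarrow> 'a set set \<Rightarrow> 'a set" where
  "subgroup_product G \<H> =
     foldr (\<lambda>H K. H <#>\<^bsub>G\<^esub> K) (SOME Hs. distinct Hs \<and> set Hs = \<H>) {\<one>\<^bsub>G\<^esub>}"

definition U_sub :: "('a, 'b) monoid_scheme \<Rightarrow> 'a sct \<Rightarrow> 'a set \<Rightarrow> 'a set" where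
  "U_sub G S N = subgroup_product G {H. S_normal G S H \<and> V_sub G S H \<subseteq> N}"

definition is_largest_subgroup ::
  "('a, 'b) monoid_scheme \<Rightarrow> ('a set \<Rightarrow> bool) \<Rightarrow> 'a set \<Rightarrow> bool" where
  "is_largest_subgroup G P U \<longleftrightarrow>
     subgroup U G \<and> P U \<and> (\<forall>H. subgroup H G \<and> P H \<longrightarrow> H \<subseteq> U)"

end

theory Submission
  imports Defs "Jordan_Normal_Form.Schur_Decomposition" "HOL-Algebra.Multiplicative_Group"
begin

text \<open>
  Both parts describe one subgroup. Call an \<open>S\<close>-character bad if it does not vanish on
  \<open>G - N\<close>, and let \<open>K\<close> be the intersection of the kernels of all bad \<open>S\<close>-characters
  (\<open>nonvanishing_ker\<close> below). For a subset \<open>H\<close> of \<open>G\<close>, every \<open>S\<close>-character whose kernel does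
  not contain \<open>H\<close> vanishes off \<open>N\<close> exactly when \<open>H\<close> lies in the kernel of every bad one, that
  is, when \<open>H \<subseteq> K\<close>; this is the contrapositive and no more (\<open>subset_nonvanishing_ker_iff\<close>).
  As \<open>N\<close> is a subgroup, \<open>V(S|H) \<le> N\<close> says the same thing, so \<open>U(S|N)\<close> is the product of the
  \<open>S\<close>-normal subgroups contained in \<open>K\<close>. If \<open>K\<close> is itself an \<open>S\<close>-normal subgroup then this
  product is \<open>K\<close>. Part (2) is then the definition of \<open>K\<close>, and part (1) the equivalence above
  for subgroups \<open>H\<close>.

  It remains to see that the kernel of an \<open>S\<close>-character \<open>\<sigma>\<close> is an \<open>S\<close>-normal subgroup. It is a
  union of \<open>S\<close>-classes because \<open>\<sigma>\<close> is constant on them. That it is closed under products is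
  the substantial point. Write \<open>\<sigma>\<close> as the sum of \<open>\<chi>(1) \<chi>\<close> over a set of irreducible characters.
  Every value of \<open>\<chi>\<close> has real part at most \<open>\<chi>(1) > 0\<close>, so \<open>\<sigma>(g) = \<sigma>(1)\<close> forces equality for each
  \<open>\<chi>\<close>, and for a representation affording \<open>\<chi>\<close> equality forces \<open>g\<close> to act as the identity:
  \<open>finite_order_mat_trace\<close> derives this from the fact that \<open>g\<close> acts by a matrix of finite
  order. So the kernel of \<open>\<sigma>\<close> is an intersection of kernels of homomorphisms.
\<close>

section \<open>Complex matrices of finite order\<close>

lemma upper_triangular_mat_pow:
  fixes B :: "'a :: comm_ring_1 mat"
  assumes B: "B \<in> carrier_mat n n" and "upper_triangular B" and "i < n" "j \<le> i"
  shows "(B ^\<^sub>m k) $$ (i, j) = (if i = j then (B $$ (i, i)) ^ k else 0)"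
  using assms(3-)
proof (induction k arbitrary: i j)
  case 0
  then show ?case using B by auto
next
  case (Suc k)
  have zero: "B $$ (l, j) = 0" if "j < l" "l < n" for l
    using \<open>upper_triangular B\<close> B that by auto
  have "(B ^\<^sub>m Suc k) $$ (i, j) = (\<Sum>l<n. (B ^\<^sub>m k) $$ (i, l) * B $$ (l, j))"
    using B Suc.prems pow_carrier_mat[OF B, of k]
    by (auto simp: scalar_prod_def atLeast0LessThan intro!: sum.cong)
  also have "\<dots> = (\<Sum>l<n. if l = i then (B $$ (i, i)) ^ k * B $$ (i, j) else 0)"
    using Suc zero by (intro sum.cong refl) (auto simp: not_less not_le dest!: nat_neq_iff[THEN iffD1])
  also have "\<dots> = (if i = j then (B $$ (i, i)) ^ Suc k else 0)"
    using Suc.prems zero[of i] by (auto simp: sum.delta' mult.commute)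
  finally show ?case .
qed

text \<open>
  To first order, \<open>(1 + E)\<^sup>k\<close> is \<open>1 + k E\<close>. Here \<open>E = B - 1\<close> is zero below the \<open>d\<close>-th
  superdiagonal, so the products of two or more copies of \<open>E\<close> cannot reach that superdiagonal
  and the first-order formula is exact on it.
\<close>
lemma unipotent_mat_pow_superdiagonal:
  fixes B :: "'a :: comm_ring_1 mat"
  assumes B: "B \<in> carrier_mat n n"
    and id: "\<And>i j. i < n \<Longrightarrow> j < n \<Longrightarrow> j < i + d \<Longrightarrow> B $$ (i, j) = (if i = j then 1 else 0)"
    and "0 < d" and "i < n" "j < n" "j \<le> i + d"
  shows "(B ^\<^sub>m k) $$ (i, j) = (if i = j then 1 else of_nat k * B $$ (i, j))"
  using assms(4-)
proof (induction k arbitrary: i j)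
  case 0
  then show ?case using B by auto
next
  case (Suc k)
  \<comment> \<open>An index \<open>l\<close> other than \<open>i\<close> and \<open>j\<close> contributes nothing: as \<open>j \<le> i + d\<close>, one of the
    pairs \<open>(i, l)\<close> and \<open>(l, j)\<close> lies below the \<open>d\<close>-th superdiagonal and off the diagonal.\<close>
  have summand: "(B ^\<^sub>m k) $$ (i, l) * B $$ (l, j) =
      (if l = i then B $$ (i, j) else 0) + (if l = j \<and> i \<noteq> j then of_nat k * B $$ (i, j) else 0)"
    if "l < n" for l
  proof -
    consider "l = i" | "l = j" "l \<noteq> i" | "l \<noteq> i" "l \<noteq> j" "l < i + d" | "l \<noteq> i" "l \<noteq> j" "j < l + d"
      using Suc.prems by linarith
    then show ?thesis
    proof cases
      case 1
      then show ?thesis using Suc by auto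
    next
      case 2
      then show ?thesis using Suc id[of j j] \<open>0 < d\<close> by auto
    next
      case 3
      then show ?thesis using Suc.IH[of i l] id[of i l] Suc.prems that by auto
    next
      case 4
      then show ?thesis using id[of l j] Suc.prems that by auto
    qed
  qed
  have "(B ^\<^sub>m Suc k) $$ (i, j) = (\<Sum>l<n. (B ^\<^sub>m k) $$ (i, l) * B $$ (l, j))"
    using B Suc.prems pow_carrier_mat[OF B, of k]
    by (auto simp: scalar_prod_def atLeast0LessThan intro!: sum.cong)
  also have "\<dots> = B $$ (i, j) + (if i \<noteq> j then of_nat k * B $$ (i, j) else 0)"
    using Suc.prems by (simp add: summand sum.distrib)
  also have "\<dots> = (if i = j then 1 else of_nat (Suc k) * B $$ (i, j))"
    using id[of i i] Suc.prems \<open>0 < d\<close> by (auto simp: algebra_simps)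
  finally show ?case .
qed

text \<open>
  A nonzero entry on the first superdiagonal on which \<open>B - 1\<close> does not vanish would be
  multiplied by \<open>m\<close> in \<open>B\<^sup>m\<close>, and \<open>m\<close> is invertible in characteristic \<open>0\<close>.
\<close>
lemma unipotent_mat_finite_order:
  fixes B :: "'a :: field_char_0 mat"
  assumes B: "B \<in> carrier_mat n n" and ut: "upper_triangular B"
    and diag: "\<And>i. i < n \<Longrightarrow> B $$ (i, i) = 1"
    and pow: "B ^\<^sub>m m = 1\<^sub>m n" and "0 < m"
  shows "B = 1\<^sub>m n"
proof -
  have "\<forall>i<n. \<forall>j<n. j < i + Suc d \<longrightarrow> B $$ (i, j) = (if i = j then 1 else 0)" for d
  proof (induction d)
    case 0
    then show ?case using ut B diag by (auto simp: less_Suc_eq)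
  next
    case (Suc d)
    show ?case
    proof (intro allI impI)
      fix i j assume ij: "i < n" "j < n" "j < i + Suc (Suc d)"
      have "(B ^\<^sub>m m) $$ (i, j) = (if i = j then 1 else of_nat m * B $$ (i, j))"
        using Suc.IH ij by (intro unipotent_mat_pow_superdiagonal[OF B, of "Suc d"]) auto
      then show "B $$ (i, j) = (if i = j then 1 else 0)"
        using pow diag ij \<open>0 < m\<close> by (auto split: if_splits)
    qed
  qed
  from this[of n] show ?thesis
    using B by (intro eq_matI) auto
qed

lemma sum_diag_mult_commute:
  fixes A B :: "'a :: comm_semiring_0 mat"
  assumes "A \<in> carrier_mat n m" "B \<in> carrier_mat m n"
  shows "(\<Sum>i<n. (A * B) $$ (i, i)) = (\<Sum>i<m. (B * A) $$ (i, i))"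
proof -
  have "(\<Sum>i<n. (A * B) $$ (i, i)) = (\<Sum>i<n. \<Sum>j<m. A $$ (i, j) * B $$ (j, i))"
    using assms by (auto simp: scalar_prod_def atLeast0LessThan intro!: sum.cong)
  also have "\<dots> = (\<Sum>j<m. \<Sum>i<n. B $$ (j, i) * A $$ (i, j))"
    by (subst sum.swap) (simp add: mult.commute)
  also have "\<dots> = (\<Sum>i<m. (B * A) $$ (i, i))"
    using assms by (auto simp: scalar_prod_def atLeast0LessThan intro!: sum.cong)
  finally show ?thesis .
qed

text \<open>
  Bring \<open>A\<close> into upper triangular form. The diagonal entries are roots of unity, so each has
  real part at most \<open>1\<close>, with equality only for the entry \<open>1\<close>. In the extremal case the
  triangular form is therefore unipotent, and being of finite order it is the identity.
\<close>
lemma finite_order_mat_trace: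
  fixes A :: "complex mat"
  assumes A: "A \<in> carrier_mat n n" and pow: "A ^\<^sub>m m = 1\<^sub>m n" and "0 < m"
  shows "Re (\<Sum>i<n. A $$ (i, i)) \<le> n"
    and "Re (\<Sum>i<n. A $$ (i, i)) = n \<Longrightarrow> A = 1\<^sub>m n"
proof -
  obtain B P Q where B: "B \<in> carrier_mat n n" and ut: "upper_triangular B"
    and wit: "similar_mat_wit A B P Q"
    using char_poly_factorized[OF A] schur_decomposition_exists[OF A]
    unfolding similar_mat_def by blast
  note PQ = similar_mat_witD2[OF A wit]
  have powB: "B ^\<^sub>m m = 1\<^sub>m n"
    using similar_mat_wit_pow_id[OF similar_mat_wit_sym[OF wit], of m] pow PQ by simp
  have "(\<Sum>i<n. A $$ (i, i)) = (\<Sum>i<n. (Q * (P * B)) $$ (i, i))"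
    unfolding PQ(3) using PQ by (intro sum_diag_mult_commute) auto
  also have "Q * (P * B) = B"
    using PQ by (simp flip: assoc_mult_mat)
  finally have tr: "Re (\<Sum>i<n. A $$ (i, i)) = (\<Sum>i<n. Re (B $$ (i, i)))" by simp
  have norm: "cmod (B $$ (i, i)) = 1" if "i < n" for i
  proof -
    have "(B $$ (i, i)) ^ m = 1"
      using upper_triangular_mat_pow[OF B ut that, of i m] powB that by simp
    then show ?thesis
      using \<open>0 < m\<close> by (metis power_eq_1_iff less_numeral_extra(3))
  qed
  have le: "Re (B $$ (i, i)) \<le> 1" if "i < n" for i
    using complex_Re_le_cmod[of "B $$ (i, i)"] norm[OF that] by simp
  show "Re (\<Sum>i<n. A $$ (i, i)) \<le> n"
    unfolding tr using sum_mono[of "{..<n}" "\<lambda>i. Re (B $$ (i, i))" "\<lambda>_. 1"] le by simp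
  assume "Re (\<Sum>i<n. A $$ (i, i)) = n"
  then have "(\<Sum>i<n. 1 - Re (B $$ (i, i))) = 0"
    unfolding tr by (simp add: sum_subtractf)
  then have "Re (B $$ (i, i)) = 1" if "i < n" for i
    using le that by (subst (asm) sum_nonneg_eq_0_iff) auto
  then have "B $$ (i, i) = 1" if "i < n" for i
    using norm[OF that] that by (auto simp: complex_eq_iff cmod_def)
  then have "B = 1\<^sub>m n"
    using unipotent_mat_finite_order[OF B ut _ powB \<open>0 < m\<close>] by blast
  then show "A = 1\<^sub>m n"
    using PQ by simp
qed

section \<open>Kernels of characters\<close>

lemma group_GL: "group (GL n)"
proof -
  interpret ring "ring_mat TYPE(complex) n ()" by (rule ring_mat)
  show ?thesis unfolding GL_def by (rule units_group)
qed

lemma GL_simps: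
  "\<one>\<^bsub>GL n\<^esub> = 1\<^sub>m n"
  "M \<in> carrier (GL n) \<Longrightarrow> M \<in> carrier_mat n n"
  unfolding GL_def units_of_one units_of_carrier by (auto simp: ring_mat_simps Units_def)

lemma GL_pow:
  assumes "M \<in> carrier (GL n)"
  shows "M [^]\<^bsub>GL n\<^esub> (k :: nat) = M ^\<^sub>m k"
proof (induction k)
  case 0
  then show ?case using GL_simps assms by auto
next
  case (Suc k)
  then show ?case by (simp add: GL_def units_of_mult ring_mat_simps)
qed

lemma rep_character_one:
  assumes "group G" and "\<rho> \<in> hom G (GL n)"
  shows "rep_character G n \<rho> \<one>\<^bsub>G\<^esub> = of_nat n"
proof -
  interpret group_hom G "GL n" \<rho>
    using assms group_GL by (simp add: group_hom_def group_hom_axioms_def)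
  show ?thesis unfolding rep_character_def by (simp add: GL_simps)
qed

lemma rep_character_dominated:
  assumes "group G" "finite (carrier G)" and "\<rho> \<in> hom G (GL n)" and g: "g \<in> carrier G"
  shows "Re (rep_character G n \<rho> g) \<le> n"
    and "Re (rep_character G n \<rho> g) = n \<Longrightarrow> \<rho> g = 1\<^sub>m n"
proof -
  interpret group_hom G "GL n" \<rho>
    using assms group_GL by (simp add: group_hom_def group_hom_axioms_def)
  have "\<rho> g ^\<^sub>m Coset.order G = \<rho> (g [^]\<^bsub>G\<^esub> Coset.order G)"
    using g hom_nat_pow GL_pow by simp
  also have "\<dots> = 1\<^sub>m n"
    using g G.pow_order_eq_1 GL_simps by simp
  finally have pow: "\<rho> g ^\<^sub>m Coset.order G = 1\<^sub>m n" .
  have "0 < Coset.order G"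
    using assms(2) G.order_gt_0_iff_finite by blast
  moreover have "\<rho> g \<in> carrier_mat n n"
    using g GL_simps(2) by simp
  ultimately show "Re (rep_character G n \<rho> g) \<le> n"
    and "Re (rep_character G n \<rho> g) = n \<Longrightarrow> \<rho> g = 1\<^sub>m n"
    using finite_order_mat_trace[OF _ pow] g by (simp_all add: rep_character_def)
qed

lemma char_ker_rep_character:
  assumes "group G" "finite (carrier G)" and "\<rho> \<in> hom G (GL n)"
  shows "char_ker G (rep_character G n \<rho>) = kernel G (GL n) \<rho>"
proof -
  have "rep_character G n \<rho> g = of_nat n \<longleftrightarrow> \<rho> g = 1\<^sub>m n" if "g \<in> carrier G" for g
  proof
    assume "rep_character G n \<rho> g = of_nat n"
    then show "\<rho> g = 1\<^sub>m n"
      using rep_character_dominated(2)[OF assms that] by simp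
  qed (use that in \<open>simp add: rep_character_def\<close>)
  then show ?thesis
    using rep_character_one[OF assms(1,3)] by (auto simp: char_ker_def kernel_def GL_simps)
qed

lemma Irr_dominated:
  assumes "group G" "finite (carrier G)" and "\<chi> \<in> Irr G"
  obtains n :: nat where "0 < n" "\<chi> \<one>\<^bsub>G\<^esub> = of_nat n"
    "\<And>g. g \<in> carrier G \<Longrightarrow> Re (\<chi> g) \<le> n"
    "\<And>g. g \<in> carrier G \<Longrightarrow> Re (\<chi> g) = n \<Longrightarrow> g \<in> char_ker G \<chi>"
proof -
  obtain n \<rho> where n: "0 < n" and \<rho>: "\<rho> \<in> hom G (GL n)" and \<chi>: "\<chi> = rep_character G n \<rho>"
    using assms(3) unfolding Irr_def irreducible_rep_def by blast
  show thesis
    using that[of n] n rep_character_one[OF assms(1) \<rho>] rep_character_dominated[OF assms(1,2) \<rho>]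
    unfolding \<chi> char_ker_rep_character[OF assms(1,2) \<rho>] by (simp add: kernel_def GL_simps)
qed

lemma subgroup_char_ker_Irr:
  assumes "group G" "finite (carrier G)" and "\<chi> \<in> Irr G"
  shows "subgroup (char_ker G \<chi>) G"
proof -
  obtain n \<rho> where \<rho>: "\<rho> \<in> hom G (GL n)" and \<chi>: "\<chi> = rep_character G n \<rho>"
    using assms(3) unfolding Irr_def irreducible_rep_def by blast
  interpret group_hom G "GL n" \<rho>
    using assms \<rho> group_GL by (simp add: group_hom_def group_hom_axioms_def)
  show ?thesis
    unfolding \<chi> char_ker_rep_character[OF assms(1,2) \<rho>] by (rule subgroup_kernel)
qed

text \<open>
  The difference \<open>\<sigma>(1) - \<sigma>(g)\<close> has as real part a sum of the nonnegative terms
  \<open>\<chi>(1) (\<chi>(1) - Re \<chi>(g))\<close>. It vanishes only if each term does.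
\<close>
lemma char_ker_sigma_char:
  assumes "group G" "finite (carrier G)" and X: "X \<subseteq> Irr G" "finite X"
  shows "char_ker G (sigma_char G X) = carrier G \<inter> (\<Inter>\<chi>\<in>X. char_ker G \<chi>)"
proof (intro equalityI subsetI)
  interpret group G by fact
  fix g assume "g \<in> char_ker G (sigma_char G X)"
  then have g: "g \<in> carrier G"
    and eq: "(\<Sum>\<chi>\<in>X. \<chi> \<one>\<^bsub>G\<^esub> * \<chi> g) = (\<Sum>\<chi>\<in>X. \<chi> \<one>\<^bsub>G\<^esub> * \<chi> \<one>\<^bsub>G\<^esub>)"
    by (auto simp: char_ker_def sigma_char_def)
  let ?defect = "\<lambda>\<chi>. Re (\<chi> \<one>\<^bsub>G\<^esub> * \<chi> \<one>\<^bsub>G\<^esub>) - Re (\<chi> \<one>\<^bsub>G\<^esub> * \<chi> g)"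
  have nonneg: "0 \<le> ?defect \<chi>" and ker: "?defect \<chi> = 0 \<Longrightarrow> g \<in> char_ker G \<chi>"
    if "\<chi> \<in> X" for \<chi>
  proof -
    obtain n :: nat where n: "0 < n" "\<chi> \<one>\<^bsub>G\<^esub> = of_nat n" "Re (\<chi> g) \<le> n"
      "Re (\<chi> g) = n \<Longrightarrow> g \<in> char_ker G \<chi>"
      using Irr_dominated[OF assms(1,2) subsetD[OF X(1) \<open>\<chi> \<in> X\<close>]] g by metis
    have "?defect \<chi> = n * (n - Re (\<chi> g))"
      using n(2) by (simp add: algebra_simps)
    then show "0 \<le> ?defect \<chi>" and "?defect \<chi> = 0 \<Longrightarrow> g \<in> char_ker G \<chi>"
      using n by auto
  qed
  have "(\<Sum>\<chi>\<in>X. ?defect \<chi>) = 0"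
    using arg_cong[OF eq, of Re] by (simp only: sum_subtractf Re_sum)
  then have "\<forall>\<chi>\<in>X. ?defect \<chi> = 0"
    using nonneg by (subst (asm) sum_nonneg_eq_0_iff[OF X(2)]) auto
  then show "g \<in> carrier G \<inter> (\<Inter>\<chi>\<in>X. char_ker G \<chi>)"
    using ker g by blast
next
  interpret group G by fact
  fix g assume "g \<in> carrier G \<inter> (\<Inter>\<chi>\<in>X. char_ker G \<chi>)"
  then show "g \<in> char_ker G (sigma_char G X)"
    by (auto simp: char_ker_def sigma_char_def intro!: sum.cong)
qed

text \<open>The intersection with the carrier gives an empty family its expected meaning.\<close>
lemma (in group) subgroup_carrier_Int_Inter:
  assumes "\<And>H. H \<in> \<H> \<Longrightarrow> subgroup H G"
  shows "subgroup (carrier G \<inter> \<Inter>\<H>) G"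
  using subgroups_Inter[of "insert (carrier G) \<H>"] assms subgroup_self by auto

lemma subgroup_char_ker_sigma_char:
  assumes "group G" "finite (carrier G)" and X: "X \<subseteq> Irr G"
  shows "subgroup (char_ker G (sigma_char G X)) G"
proof -
  interpret group G by fact
  show ?thesis
  proof (cases "finite X")
    case True
    then show ?thesis
      unfolding char_ker_sigma_char[OF assms True]
      using subgroup_char_ker_Irr[OF assms(1,2)] X by (intro subgroup_carrier_Int_Inter) auto
  next
    \<comment> \<open>A sum over an infinite set is \<open>0\<close> by convention, so the kernel is all of \<open>G\<close>.\<close>
    case False
    then have "char_ker G (sigma_char G X) = carrier G"
      by (auto simp: char_ker_def sigma_char_def)
    then show ?thesis using subgroup_self by simp
  qed
qed

section \<open>The subgroup \<open>U(S|N)\<close> as an intersection of kernels\<close>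

lemma S_normal_Inter_char_ker:
  assumes "group G" "finite (carrier G)" and S: "supercharacter_theory G S" and A: "A \<subseteq> Irr_S G S"
  shows "S_normal G S (carrier G \<inter> (\<Inter>\<chi>\<in>A. char_ker G \<chi>))" (is "S_normal G S ?K")
proof -
  interpret group G by fact
  have part: "partition_on (Irr G) (fst S)" "partition_on (carrier G) (snd S)"
    and const: "\<And>X Y. X \<in> fst S \<Longrightarrow> Y \<in> snd S \<Longrightarrow> \<exists>c. \<forall>g\<in>Y. sigma_char G X g = c"
    using S unfolding supercharacter_theory_def by auto
  have "subgroup (char_ker G \<chi>) G" if "\<chi> \<in> A" for \<chi>
    using that A subgroup_char_ker_sigma_char[OF assms(1,2)] partition_onD1[OF part(1)]
    unfolding Irr_S_def by blast
  then have "subgroup ?K G"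
    by (intro subgroup_carrier_Int_Inter) auto
  moreover have "?K = \<Union>{Y \<in> snd S. Y \<subseteq> ?K}"
  proof (intro equalityI subsetI)
    fix g assume g: "g \<in> ?K"
    then obtain Y where Y: "Y \<in> snd S" "g \<in> Y"
      using partition_onD1[OF part(2)] by blast
    have "h \<in> ?K" if "h \<in> Y" for h
    proof -
      have h: "h \<in> carrier G"
        using that Y(1) partition_onD1[OF part(2)] by blast
      have "\<chi> h = \<chi> \<one>\<^bsub>G\<^esub>" if "\<chi> \<in> A" for \<chi>
      proof -
        obtain X where X: "X \<in> fst S" "\<chi> = sigma_char G X"
          using subsetD[OF A \<open>\<chi> \<in> A\<close>] unfolding Irr_S_def by blast
        obtain c where "\<forall>g\<in>Y. sigma_char G X g = c"
          using const[OF X(1) Y(1)] by blast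
        then have "\<chi> h = \<chi> g"
          using Y(2) \<open>h \<in> Y\<close> X(2) by simp
        then show ?thesis
          using g that by (simp add: char_ker_def)
      qed
      then show ?thesis
        using h by (simp add: char_ker_def)
    qed
    then show "g \<in> \<Union>{Y \<in> snd S. Y \<subseteq> ?K}"
      using Y by blast
  qed auto
  ultimately show ?thesis
    unfolding S_normal_def by (intro conjI exI[of _ "{Y \<in> snd S. Y \<subseteq> ?K}"]) auto
qed

text \<open>
  A product of subgroups contains each factor, because the other factors contain the identity,
  and it stays inside every subgroup that contains all of them. So the product of a family with a
  greatest member is that member, in whatever order it is taken.
\<close>
lemma subgroup_product_greatest:
  fixes G (structure)
  assumes "group G" "finite \<H>" and K: "subgroup K G" "K \<in> \<H>"
    and \<H>: "\<And>H. H \<in> \<H> \<Longrightarrow> subgroup H G \<and> H \<subseteq> K"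
  shows "subgroup_product G \<H> = K"
proof -
  interpret group G by fact
  define Hs where "Hs = (SOME Hs. distinct Hs \<and> set Hs = \<H>)"
  have Hs: "set Hs = \<H>"
    unfolding Hs_def using finite_distinct_list[OF assms(2)]
    by (metis (mono_tags, lifting) someI_ex)
  have "foldr (\<lambda>H K. H <#>\<^bsub>G\<^esub> K) Ls {\<one>} \<subseteq> K \<and> \<one> \<in> foldr (\<lambda>H K. H <#>\<^bsub>G\<^esub> K) Ls {\<one>} \<and>
      \<Union>(set Ls) \<subseteq> foldr (\<lambda>H K. H <#>\<^bsub>G\<^esub> K) Ls {\<one>}" if "set Ls \<subseteq> \<H>" for Ls
    using that
  proof (induction Ls)
    case Nil
    then show ?case using subgroup.one_closed[OF K(1)] by simp
  next
    case (Cons H Ls)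
    let ?P = "foldr (\<lambda>H K. H <#>\<^bsub>G\<^esub> K) Ls {\<one>}"
    have P: "?P \<subseteq> K" "\<one> \<in> ?P" "\<Union>(set Ls) \<subseteq> ?P"
      using Cons by auto
    have H: "subgroup H G" "H \<subseteq> K"
      using Cons.prems \<H> by auto
    note carr = subgroup.mem_carrier[OF K(1)]
    have "H <#> ?P \<subseteq> K"
      using H(2) P(1) subgroup.m_closed[OF K(1)] by (auto simp: set_mult_def)
    moreover have "h \<in> H <#> ?P" if "h \<in> H" for h
    proof -
      have "h \<otimes> \<one> \<in> H <#> ?P"
        using that P(2) unfolding set_mult_def by blast
      then show ?thesis
        using that H(2) carr by (simp add: subsetD)
    qed
    moreover have "p \<in> H <#> ?P" if "p \<in> ?P" for p
    proof -
      have "\<one> \<otimes> p \<in> H <#> ?P"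
        using that subgroup.one_closed[OF H(1)] unfolding set_mult_def by blast
      then show ?thesis
        using that P(1) carr by (simp add: subsetD)
    qed
    ultimately show ?case
      using P by auto
  qed
  from this[of Hs] show ?thesis
    unfolding subgroup_product_def Hs_def[symmetric] using Hs K(2) by blast
qed

lemma V_sub_subset_iff:
  assumes "group G" and "subgroup N G"
  shows "V_sub G S H \<subseteq> N \<longleftrightarrow> (\<forall>\<chi>\<in>Irr_S_rel G S H. vanishes_on \<chi> (carrier G - N))"
proof -
  interpret group G by fact
  have "V_sub G S H \<subseteq> N \<longleftrightarrow> {g \<in> carrier G. \<exists>\<chi>\<in>Irr_S_rel G S H. \<chi> g \<noteq> 0} \<subseteq> N"
    (is "_ \<longleftrightarrow> ?supp \<subseteq> N")
    unfolding V_sub_def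
    using generate_subgroup_incl[OF _ assms(2)] generate.incl[of _ ?supp G] by (meson subset_iff)
  then show ?thesis
    unfolding vanishes_on_def by blast
qed

definition nonvanishing_ker :: "('a, 'b) monoid_scheme \<Rightarrow> 'a sct \<Rightarrow> 'a set \<Rightarrow> 'a set" where
  "nonvanishing_ker G S N = carrier G \<inter>
     (\<Inter>\<chi>\<in>{\<chi> \<in> Irr_S G S. \<not> vanishes_on \<chi> (carrier G - N)}. char_ker G \<chi>)"

lemma S_normal_nonvanishing_ker:
  assumes "group G" "finite (carrier G)" and "supercharacter_theory G S"
  shows "S_normal G S (nonvanishing_ker G S N)"
  unfolding nonvanishing_ker_def by (rule S_normal_Inter_char_ker[OF assms]) auto

lemma subset_nonvanishing_ker_iff:
  assumes "H \<subseteq> carrier G"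
  shows "H \<subseteq> nonvanishing_ker G S N \<longleftrightarrow>
    (\<forall>\<chi>\<in>Irr_S_rel G S H. vanishes_on \<chi> (carrier G - N))"
  using assms unfolding nonvanishing_ker_def Irr_S_rel_def by blast

lemma U_sub_eq_nonvanishing_ker:
  assumes "group G" "finite (carrier G)" and "supercharacter_theory G S" and "subgroup N G"
  shows "U_sub G S N = nonvanishing_ker G S N"
proof -
  have "V_sub G S H \<subseteq> N \<longleftrightarrow> H \<subseteq> nonvanishing_ker G S N" if "S_normal G S H" for H
  proof -
    have "H \<subseteq> carrier G"
      using that subgroup.subset unfolding S_normal_def by auto
    then show ?thesis
      by (simp only: V_sub_subset_iff[OF assms(1,4)] subset_nonvanishing_ker_iff)
  qed
  then have fam: "{H. S_normal G S H \<and> V_sub G S H \<subseteq> N} =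
      {H. S_normal G S H \<and> H \<subseteq> nonvanishing_ker G S N}"
    by auto
  have "S_normal G S (nonvanishing_ker G S N)"
    by (rule S_normal_nonvanishing_ker[OF assms(1-3)])
  moreover have "finite {H. S_normal G S H \<and> H \<subseteq> nonvanishing_ker G S N}"
    by (rule finite_subset[of _ "Pow (carrier G)"])
      (use assms(2) in \<open>auto simp: nonvanishing_ker_def\<close>)
  ultimately show ?thesis
    unfolding U_sub_def fam
    by (intro subgroup_product_greatest[OF assms(1)]) (auto simp: S_normal_def)
qed

theorem theorem1p2:
  fixes G :: "('a, 'b) monoid_scheme" and S :: "'a sct"
  assumes "group G" and "finite (carrier G)"
    and "supercharacter_theory G S"
    and "\<not> S_abelian G S"
  shows
    "(\<forall>N. S_normal G S N \<longrightarrow>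
        (\<forall>U. is_largest_subgroup G
               (\<lambda>U. \<forall>\<chi>\<in>Irr_S_rel G S U. vanishes_on \<chi> (carrier G - N)) U
             \<longleftrightarrow> U = U_sub G S N)) \<and>
     (\<forall>N. S_normal G S N \<longrightarrow>
        (\<forall>g\<in>carrier G. g \<in> U_sub G S N \<longleftrightarrow>
           (\<forall>\<chi>\<in>Irr_S G S. g \<notin> char_ker G \<chi> \<longrightarrow> vanishes_on \<chi> (carrier G - N))))"
proof (intro conjI allI impI ballI)
  fix N U assume "S_normal G S N"
  then have U_sub: "U_sub G S N = nonvanishing_ker G S N"
    using U_sub_eq_nonvanishing_ker[OF assms(1-3)] by (simp add: S_normal_def)
  have sub: "subgroup (nonvanishing_ker G S N) G"
    using S_normal_nonvanishing_ker[OF assms(1-3)] by (simp add: S_normal_def)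
  have "is_largest_subgroup G (\<lambda>U. \<forall>\<chi>\<in>Irr_S_rel G S U. vanishes_on \<chi> (carrier G - N)) U \<longleftrightarrow>
      subgroup U G \<and> U \<subseteq> nonvanishing_ker G S N \<and>
      (\<forall>H. subgroup H G \<and> H \<subseteq> nonvanishing_ker G S N \<longrightarrow> H \<subseteq> U)"
    unfolding is_largest_subgroup_def
    by (simp add: subset_nonvanishing_ker_iff[OF subgroup.subset] cong: conj_cong)
  also have "\<dots> \<longleftrightarrow> U = U_sub G S N"
    unfolding U_sub using sub by (auto intro!: equalityI)
  finally show "is_largest_subgroup G
      (\<lambda>U. \<forall>\<chi>\<in>Irr_S_rel G S U. vanishes_on \<chi> (carrier G - N)) U \<longleftrightarrow> U = U_sub G S N" .
next
  fix N g assume "S_normal G S N" and "g \<in> carrier G"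
  then show "g \<in> U_sub G S N \<longleftrightarrow>
      (\<forall>\<chi>\<in>Irr_S G S. g \<notin> char_ker G \<chi> \<longrightarrow> vanishes_on \<chi> (carrier G - N))"
    using U_sub_eq_nonvanishing_ker[OF assms(1-3)]
    by (auto simp: S_normal_def nonvanishing_ker_def)
qed

end
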